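(* Let $q$ be a natural number ($q\ge 1$). (a) If $q$ is even then $$\sum_{t=1}^q 4^t \, c_{q-t} \, K_{2t}^{2q}(q) =0.$$ (b) If $q$ is odd then $$c_{q} = - \sum_{t=1}^q 2^{2t-1} \, c_{q-t} \, K_{2t}^{2q}(q).$$
   Context: $c_m=\binom{2m}{m}$ ($m\ge 0$) is the $m$-th central binomial coefficient. For $0\le p\le n$ the binary Krawtchouk polynomial of order $n$ and degree $p$ is $K_p^n(x) = \sum_{i=0}^p (-1)^i \binom{x}{i}\binom{n-x}{p-i}$. *)

theory Defs
  imports Complex_Main
begin

definition central_binom :: "nat \<Rightarrow> nat" where
  "central_binom m = (2 * m) choose m"

text \<open>The binary Krawtchouk polynomial of order \<open>n\<close> and degree \<open>p\<close>, meant for \<open>p \<le> n\<close>.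
  It is a polynomial in \<open>x\<close>, so the binomial coefficients are the generalised ones.\<close>

definition krawtchouk :: "nat \<Rightarrow> nat \<Rightarrow> real \<Rightarrow> real" where
  "krawtchouk n p x = (\<Sum>i=0..p. (-1) ^ i * (x gchoose i) * ((real n - x) gchoose (p - i)))"

end

theory Submission
  imports Defs "HOL-Computational_Algebra.Polynomial"
begin

text \<open>Since \<open>K\<^sub>p\<^sup>2\<^sup>q(q)\<close> is the coefficient of \<open>x\<^sup>p\<close> in \<open>(1 - x)\<^sup>q (1 + x)\<^sup>q = (1 - x\<^sup>2)\<^sup>q\<close>,
  we have \<open>K\<^sub>2\<^sub>t\<^sup>2\<^sup>q(q) = (-1)\<^sup>t (q choose t)\<close>. Comparing the coefficients of \<open>x\<^sup>q\<close> in the binomial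
  expansion of \<open>(1 - x)\<^sup>2\<^sup>q = ((1 + x)\<^sup>2 - 4x)\<^sup>q\<close> evaluates the sum over all \<open>t\<close>, including the
  term \<open>c\<^sub>q\<close> for \<open>t = 0\<close>, to \<open>(-1)\<^sup>q c\<^sub>q\<close>.\<close>

lemma coeff_linear_power_real:
  "coeff ([:1, b:] ^ n) i = real (n choose i) * b ^ i"
proof (cases "i \<le> n")
  case True
  then show ?thesis
    by (simp add: coeff_linear_poly_power)
next
  case False
  have "degree ([:1, b:] ^ n) \<le> 1 * n"
    by (rule order_trans[OF degree_power_le]) simp
  with False have "coeff ([:1, b:] ^ n) i = 0"
    by (intro coeff_eq_0) linarith
  with False show ?thesis
    by (simp add: binomial_eq_0)
qed

text \<open>At \<open>x = m\<close> the generalised binomials have natural upper arguments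
  \<open>m\<close> and \<open>n\<close>, so the defining sum is the Cauchy product of two binomial
  expansions.\<close>

lemma krawtchouk_eq_coeff:
  "krawtchouk (m + n) p (real m) = coeff ([:1, -1:] ^ m * [:1, 1:] ^ n) p"
  unfolding krawtchouk_def coeff_mult atLeast0AtMost
  by (simp add: coeff_linear_power_real binomial_gbinomial mult_ac)

lemma krawtchouk_middle_even:
  "krawtchouk (2 * q) (2 * t) (real q) = (-1) ^ t * real (q choose t)"
proof -
  have "([:1, -1:] :: real poly) ^ q * [:1, 1:] ^ q = (monom (-1) 2 + 1) ^ q"
    by (simp add: monom_altdef power2_eq_square one_pCons flip: power_mult_distrib)
  also have "\<dots> = (\<Sum>k\<le>q. monom (real (q choose k) * (-1) ^ k) (2 * k))"
    by (simp add: binomial_ring monom_power of_nat_monom mult_monom mult_ac)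
  finally have "krawtchouk (2 * q) (2 * t) (real q) =
      (\<Sum>k\<le>q. if k = t then real (q choose k) * (-1) ^ k else 0)"
    using krawtchouk_eq_coeff[of q q "2 * t"] by (simp add: coeff_sum flip: mult_2)
  \<comment> \<open>For \<open>t > q\<close> no index \<open>k\<close> hits \<open>t\<close>, and
    \<open>q choose t\<close> vanishes too.\<close>
  then show ?thesis
    by (auto simp: not_le binomial_eq_0)
qed

lemma sum_binomial_central_binom:
  "(\<Sum>t\<le>q. (-4) ^ t * real (q choose t) * real (central_binom (q - t))) =
     (-1) ^ q * real (central_binom q)"
proof -
  have linear: "monom (-4 :: real) 1 = [:0, -4:]"
    by (simp add: monom_altdef)
  have "([:1, -1:] :: real poly) ^ (2 * q) = ([:0, -4:] + [:1, 1:]\<^sup>2) ^ q"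
    by (simp add: power_mult power2_eq_square)
  also have "\<dots> = (\<Sum>t\<le>q. smult (real (q choose t)) ([:0, -4:] ^ t * [:1, 1:] ^ (2 * (q - t))))"
    by (simp add: binomial_ring of_nat_poly flip: power_mult)
  also have "\<dots> = (\<Sum>t\<le>q. monom (real (q choose t) * (-4) ^ t) t * [:1, 1:] ^ (2 * (q - t)))"
    by (simp add: monom_power smult_monom flip: linear mult_smult_left)
  finally have "coeff ([:1, -1:] ^ (2 * q)) q =
      coeff (\<Sum>t\<le>q. monom (real (q choose t) * (-4) ^ t) t * [:1, 1:] ^ (2 * (q - t))) q"
    by simp
  \<comment> \<open>The monomial of degree \<open>t\<close> shifts the index to
    \<open>q - t\<close>, the middle coefficient of \<open>[:1, 1:] ^ (2 * (q - t))\<close>.\<close>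
  then show ?thesis
    unfolding coeff_sum coeff_monom_mult
    by (simp add: coeff_linear_power_real central_binom_def mult_ac)
qed

theorem proposition5p5:
  fixes q :: nat
  assumes "q \<ge> 1"
  shows "(even q \<longrightarrow>
           (\<Sum>t=1..q. 4 ^ t * real (central_binom (q - t)) * krawtchouk (2 * q) (2 * t) (real q)) = 0) \<and>
         (odd q \<longrightarrow>
           real (central_binom q) =
             - (\<Sum>t=1..q. 2 ^ (2 * t - 1) * real (central_binom (q - t)) * krawtchouk (2 * q) (2 * t) (real q)))"
proof -
  define S where
    "S = (\<Sum>t=1..q. 4 ^ t * real (central_binom (q - t)) * krawtchouk (2 * q) (2 * t) (real q))"
  have "(-4) ^ t = 4 ^ t * (-1 :: real) ^ t" for t
    by (simp flip: power_mult_distrib)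
  then have "S = (\<Sum>t=1..q. (-4) ^ t * real (q choose t) * real (central_binom (q - t)))"
    unfolding S_def krawtchouk_middle_even by (simp add: mult_ac)
  then have S: "real (central_binom q) + S = (-1) ^ q * real (central_binom q)"
    using sum_binomial_central_binom[of q]
    by (simp add: atMost_atLeast0 sum.atLeast_Suc_atMost)
  \<comment> \<open>As \<open>t \<ge> 1\<close>, the subtraction is not truncated and the power of 2
    is \<open>4 ^ t / 2\<close>.\<close>
  have "(\<Sum>t=1..q. 2 ^ (2 * t - 1) * real (central_binom (q - t)) *
      krawtchouk (2 * q) (2 * t) (real q)) = S / 2"
    unfolding S_def sum_divide_distrib
    by (rule sum.cong) (auto simp: power_diff power_mult)
  \<comment> \<open>By parity of \<open>q\<close>, \<open>S\<close> is 0 or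
    \<open>-2 * central_binom q\<close>.\<close>
  with S show ?thesis
    by (auto simp: S_def)
qed

end
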